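(* Let $G$ be a sofic group and let $k$ be a field. Suppose that $\alpha, \beta \in R(k,G)$ satisfy $\alpha \star \beta = X_{1_G}$. Then $\beta \star \alpha = X_{1_G}$.
   Context: Let $G$ be a group with identity $1_G$ and let $k$ be a field. The near ring $(R(k,G),+,\star)$ is defined as follows. As an additive group, $R(k,G) = k[X_g : g \in G]$, the commutative polynomial ring in indeterminates indexed by $G$. Let $\mathbb{N}[G]$ be the set of functions $u \colon G \to \mathbb{N}$ (with $0 \in \mathbb{N}$) such that $u(g) \neq 0$ for only finitely many $g \in G$. For $u \in \mathbb{N}[G]$ put $X^u = \prod_{g \in G} X_g^{u(g)}$ (with $X_g^0 = 1$). Every element of $R(k,G)$ is uniquely of the form $\sum_{u \in \mathbb{N}[G]} \alpha(u) X^u$ with $\alpha(u) \in k$ and $\alpha(u) \neq 0$ for finitely many $u$. The group $G$ acts on $\mathbb{N}[G]$ by $(gu)(h) = u(g^{-1}h)$ and on $R(k,G)$ by $g\gamma = \sum_{w} \gamma(w) X^{gw}$ for $\gamma = \sum_w \gamma(w) X^w$ (so $g X_h = X_{gh}$). For $\alpha = \sum_u \alpha(u) X^u$ and $\beta \in R(k,G)$, the multiplication is $$\alpha \star \beta = \sum_{u \in \mathbb{N}[G]} \alpha(u) \prod_{g \in G} (g\beta)^{u(g)},$$ where the products and powers on the right are the usual ones in the polynomial ring. The element $X_{1_G}$ is the identity for $\star$. A group $G$ is sofic if for every finite $F \subset G$ and every $\varepsilon > 0$ there exist $n \geq 1$ and a map $\varphi \colon G \to \mathrm{Sym}(n)$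 such that, for the normalized Hamming distance $d$ on $\mathrm{Sym}(n)$, $d(\varphi(gh), \varphi(g)\varphi(h)) \leq \varepsilon$ for all $g,h \in F$ and $d(\varphi(g),\varphi(h)) \geq 1-\varepsilon$ for all distinct $g,h \in F$. *)

theory Defs
  imports Complex_Main "HOL-Library.Poly_Mapping" "HOL-Combinatorics.Permutations"
begin

text \<open>
  A group is a type of class \<^class>\<open>group_add\<close>, which does not assume commutativity.  So the
  group law is written additively: \<open>g + h\<close> is the product \<open>gh\<close>, \<open>- g\<close> is the inverse, and
  \<open>0\<close> is the identity \<open>1\<^sub>G\<close>.
\<close>

definition hamming_dist :: "nat \<Rightarrow> (nat \<Rightarrow> nat) \<Rightarrow> (nat \<Rightarrow> nat) \<Rightarrow> real" where
  "hamming_dist n \<sigma> \<tau> = real (card {i \<in> {..<n}. \<sigma> i \<noteq> \<tau> i}) / real n"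

text \<open>Here \<open>Sym(n)\<close> is the set of functions that permute \<open>{..<n}\<close>.\<close>

definition sofic :: "'g::group_add itself \<Rightarrow> bool" where
  "sofic _ \<longleftrightarrow>
    (\<forall>F :: 'g set. finite F \<longrightarrow> (\<forall>\<epsilon> :: real. \<epsilon> > 0 \<longrightarrow>
      (\<exists>(n :: nat) (\<phi> :: 'g \<Rightarrow> nat \<Rightarrow> nat).
        n \<ge> 1 \<and>
        (\<forall>g. \<phi> g permutes {..<n}) \<and>
        (\<forall>g\<in>F. \<forall>h\<in>F. hamming_dist n (\<phi> (g + h)) (\<phi> g \<circ> \<phi> h) \<le> \<epsilon>) \<and>
        (\<forall>g\<in>F. \<forall>h\<in>F. g \<noteq> h \<longrightarrow> hamming_dist n (\<phi> g) (\<phi> h) \<ge> 1 - \<epsilon>))))"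

text \<open>
  An exponent \<open>u \<in> \<nat>[G]\<close> is an element of \<^typ>\<open>'g \<Rightarrow>\<^sub>0 nat\<close>.  The type below is the polynomial
  ring \<open>k[X\<^sub>g : g \<in> G]\<close>: \<^const>\<open>Poly_Mapping.lookup\<close> gives the coefficients, and the type class
  operations \<open>+\<close>, \<open>*\<close>, \<open>^\<close> are the usual ones of polynomials.
\<close>

type_synonym ('g, 'k) near_ring = "('g \<Rightarrow>\<^sub>0 nat) \<Rightarrow>\<^sub>0 'k"

definition var :: "'g \<Rightarrow> ('g, 'k::field) near_ring" where
  "var g = Poly_Mapping.single (Poly_Mapping.single g 1) 1"

definition act_exp :: "'g::group_add \<Rightarrow> ('g \<Rightarrow>\<^sub>0 nat) \<Rightarrow> ('g \<Rightarrow>\<^sub>0 nat)" where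
  "act_exp g u = Poly_Mapping.map_key (\<lambda>h. - g + h) u"

text \<open>\<^const>\<open>Poly_Mapping.map_key\<close> is only specified for injective maps, as is the case here.\<close>

lemma lookup_act_exp: "Poly_Mapping.lookup (act_exp g u) h = Poly_Mapping.lookup u (- g + h)"
  by (simp add: act_exp_def map_key.rep_eq inj_on_def)

definition act :: "'g::group_add \<Rightarrow> ('g, 'k::field) near_ring \<Rightarrow> ('g, 'k) near_ring" where
  "act g \<gamma> = (\<Sum>w\<in>Poly_Mapping.keys \<gamma>.
     Poly_Mapping.single (act_exp g w) (Poly_Mapping.lookup \<gamma> w))"

text \<open>
  \<open>Poly_Mapping.single 0 c\<close> is the constant polynomial \<open>c\<close>.  Sum and product range over the
  supports of \<open>\<alpha>\<close> and \<open>u\<close>; the remaining summands are \<open>0\<close> and the other factors are \<open>1\<close>.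
\<close>

definition star :: "('g::group_add, 'k::field) near_ring \<Rightarrow> ('g, 'k) near_ring \<Rightarrow> ('g, 'k) near_ring"
    (infixl "\<star>" 70) where
  "\<alpha> \<star> \<beta> = (\<Sum>u\<in>Poly_Mapping.keys \<alpha>.
     Poly_Mapping.single 0 (Poly_Mapping.lookup \<alpha> u) *
       (\<Prod>g\<in>Poly_Mapping.keys u. act g \<beta> ^ Poly_Mapping.lookup u g))"

end

theory Submission
  imports Defs
begin

text \<open>
  The product \<open>\<alpha> \<star> \<beta>\<close> is the substitution \<open>X\<^sub>g \<mapsto> g\<beta>\<close> in \<open>\<alpha>\<close>.  Hence \<open>\<star>\<close> is associative and
  additive in its left argument, and \<open>P = \<beta> \<star> \<alpha> - X\<^sub>1\<close> satisfies
  \<open>P \<star> \<beta> = \<beta> \<star> (\<alpha> \<star> \<beta>) - \<beta> = 0\<close>.  So it suffices that a \<open>\<beta>\<close> with a left inverse has no nonzero left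
  annihilator (\<open>star_right_cancel_zero\<close>).  This is where soficity enters, through a count of
  dimensions.

  Soficity provides a finite set \<open>V\<close> of \<open>n\<close> points on which the elements of \<open>G\<close> act by permutations
  \<open>\<psi> g\<close>, such that on all but a small proportion of the points, forming \<open>H \<subseteq> V\<close>, the finitely many
  group elements that occur in \<open>\<alpha>\<close>, \<open>\<beta>\<close> and \<open>P\<close> act as by translations (\<open>sofic_finite_model\<close>).
  Transfer a polynomial \<open>\<gamma>\<close> to the point \<open>v\<close> by \<open>X\<^sub>g \<mapsto> Y\<^bsub>\<psi> g v\<^esub>\<close>; this gives polynomials in the \<open>n\<close>
  variables \<open>Y\<^sub>v\<close>.  Let \<open>b\<^sub>v\<close> be the transfer of \<open>\<beta>\<close> to \<open>v\<close>.  For \<open>v \<in> H\<close>, the transfer of \<open>\<alpha>\<close> to \<open>v\<close>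
  takes the value \<open>Y\<^sub>v\<close> at the family \<open>b\<close>, while the transfer of \<open>P\<close> to \<open>v\<close> vanishes there.  If
  \<open>P \<noteq> 0\<close>, the latter is a nontrivial algebraic relation among the \<open>b\<^sub>w\<close>.  A fixed proportion of the
  points of \<open>H\<close> have pairwise disjoint neighbourhoods (\<open>disjoint_subfamily_exists\<close>); let \<open>S\<close> be the
  set of these.  So the algebra generated by the \<open>n\<close> polynomials \<open>b\<^sub>v\<close> contains \<open>card H\<close>
  variables, although the generators satisfy \<open>card S\<close> relations in disjoint sets of variables.
  In terms of transcendence degree, \<open>card H \<le> n - card S\<close>
  (\<open>card_generated_plus_relations_le\<close>).  This is absurd, because \<open>card S\<close> is at least a fixed
  proportion of \<open>n\<close> and \<open>n - card H\<close> is at most an arbitrarily small one.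

  The inequality is proved by comparing growth rates.  Let \<open>a = card H\<close>.  There are \<open>(d + 1)\<^sup>a\<close>
  monomials in the variables in \<open>H\<close> with all exponents at most \<open>d\<close>, and they are linearly
  independent.  On the other hand they lie in the span of the values at \<open>b\<close> of monomials of degree
  \<open>O(d)\<close>.  By division by the relations only those monomials are needed that no leading monomial of
  a relation divides.  Such a monomial has a bounded exponent in at least one variable of each
  relation, so there are only \<open>O(d\<^bsup>r\<^esup>)\<close> of them, where \<open>r = n - card S\<close>.
\<close>
section \<open>Substitution\<close>

definition monomial_subst :: "('x \<Rightarrow> 'a::comm_monoid_mult) \<Rightarrow> ('x \<Rightarrow>\<^sub>0 nat) \<Rightarrow> 'a" where
  "monomial_subst \<theta> u = (\<Prod>g\<in>Poly_Mapping.keys u. \<theta> g ^ Poly_Mapping.lookup u g)"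

definition poly_subst ::
    "('x \<Rightarrow> ('y, 'k::field) near_ring) \<Rightarrow> ('x, 'k) near_ring \<Rightarrow> ('y, 'k) near_ring" where
  "poly_subst \<theta> p = (\<Sum>u\<in>Poly_Mapping.keys p.
     Poly_Mapping.single 0 (Poly_Mapping.lookup p u) * monomial_subst \<theta> u)"

definition vars :: "('x, 'k::field) near_ring \<Rightarrow> 'x set" where
  "vars p = (\<Union>u\<in>Poly_Mapping.keys p. Poly_Mapping.keys u)"

lemma finite_vars: "finite (vars p)"
  by (simp add: vars_def)

lemma monomial_subst_superset:
  assumes "finite U" "Poly_Mapping.keys u \<subseteq> U"
  shows "monomial_subst \<theta> u = (\<Prod>g\<in>U. \<theta> g ^ Poly_Mapping.lookup u g)"
  unfolding monomial_subst_def
  by (rule prod.mono_neutral_left) (use assms in \<open>auto simp: in_keys_iff\<close>)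

lemma monomial_subst_0 [simp]: "monomial_subst \<theta> 0 = 1"
  by (simp add: monomial_subst_def)

lemma monomial_subst_single [simp]: "monomial_subst \<theta> (Poly_Mapping.single g n) = \<theta> g ^ n"
  by (simp add: monomial_subst_def)

lemma monomial_subst_add:
  "monomial_subst \<theta> (u + w) = monomial_subst \<theta> u * monomial_subst \<theta> w"
proof -
  let ?U = "Poly_Mapping.keys u \<union> Poly_Mapping.keys w"
  have "Poly_Mapping.keys (u + w) \<subseteq> ?U" by (rule Poly_Mapping.keys_add)
  then show ?thesis
    by (simp add: monomial_subst_superset[of ?U] lookup_add power_add prod.distrib)
qed

lemma monomial_subst_cong:
  assumes "\<And>g. g \<in> Poly_Mapping.keys u \<Longrightarrow> \<theta> g = \<eta> g"
  shows "monomial_subst \<theta> u = monomial_subst \<eta> u"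
  unfolding monomial_subst_def using assms by (intro prod.cong) auto

lemma poly_subst_superset:
  assumes "finite U" "Poly_Mapping.keys p \<subseteq> U"
  shows "poly_subst \<theta> p =
    (\<Sum>u\<in>U. Poly_Mapping.single 0 (Poly_Mapping.lookup p u) * monomial_subst \<theta> u)"
  unfolding poly_subst_def
  by (rule sum.mono_neutral_left) (use assms in \<open>auto simp: in_keys_iff\<close>)

lemma poly_subst_0 [simp]: "poly_subst \<theta> 0 = 0"
  by (simp add: poly_subst_def)

lemma poly_subst_single [simp]:
  "poly_subst \<theta> (Poly_Mapping.single u c) = Poly_Mapping.single 0 c * monomial_subst \<theta> u"
  by (simp add: poly_subst_def)

lemma poly_subst_1 [simp]: "poly_subst \<theta> 1 = 1"
  by (metis monomial_subst_0 mult_1 poly_subst_single single_one)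

lemma poly_subst_var [simp]: "poly_subst \<theta> (var g) = \<theta> g"
  by (simp add: var_def)

lemma poly_subst_add: "poly_subst \<theta> (p + q) = poly_subst \<theta> p + poly_subst \<theta> q"
proof -
  let ?U = "Poly_Mapping.keys p \<union> Poly_Mapping.keys q"
  have "Poly_Mapping.keys (p + q) \<subseteq> ?U" by (rule Poly_Mapping.keys_add)
  then show ?thesis
    by (simp add: poly_subst_superset[of ?U] lookup_add single_add distrib_right sum.distrib)
qed

lemma poly_subst_diff: "poly_subst \<theta> (p - q) = poly_subst \<theta> p - poly_subst \<theta> q"
  by (metis add_diff_cancel diff_add_cancel poly_subst_add)

lemma poly_subst_sum: "poly_subst \<theta> (\<Sum>i\<in>I. p i) = (\<Sum>i\<in>I. poly_subst \<theta> (p i))"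
  by (induction I rule: infinite_finite_induct) (simp_all add: poly_subst_add)

lemma poly_as_sum:
  "p = (\<Sum>u\<in>Poly_Mapping.keys p. Poly_Mapping.single u (Poly_Mapping.lookup p u))"
  by (rule poly_mapping_eqI)
     (auto simp: lookup_sum lookup_single when_def in_keys_iff sum.delta'[OF finite_keys])

text \<open>
  Both sides are biadditive, so that it suffices to treat terms with a single monomial.
\<close>
lemma poly_subst_mult:
  fixes \<theta> :: "'x \<Rightarrow> ('y, 'k::field) near_ring"
  shows "poly_subst \<theta> (p * q) = poly_subst \<theta> p * poly_subst \<theta> q"
proof -
  have "poly_subst \<theta> (Poly_Mapping.single u c * Poly_Mapping.single w d) =
      poly_subst \<theta> (Poly_Mapping.single u c) * poly_subst \<theta> (Poly_Mapping.single w d)" for u w c d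
  proof -
    have "Poly_Mapping.single 0 (c * d) =
        Poly_Mapping.single 0 c * (Poly_Mapping.single 0 d :: ('y, 'k) near_ring)"
      by (simp add: mult_single)
    then show ?thesis
      by (simp only: mult_single[of u c w d] poly_subst_single monomial_subst_add mult_ac)
  qed
  then show ?thesis
    by (subst (1 2) poly_as_sum[of p], subst (1 2) poly_as_sum[of q])
       (simp only: sum_product poly_subst_sum)
qed

lemma poly_subst_power: "poly_subst \<theta> (p ^ n) = poly_subst \<theta> p ^ n"
  by (induction n) (simp_all add: poly_subst_mult)

lemma poly_subst_prod: "poly_subst \<theta> (\<Prod>i\<in>I. p i) = (\<Prod>i\<in>I. poly_subst \<theta> (p i))"
  by (induction I rule: infinite_finite_induct) (simp_all add: poly_subst_mult)

lemma poly_subst_monomial_subst: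
  "poly_subst \<theta> (monomial_subst \<eta> u) = monomial_subst (\<lambda>x. poly_subst \<theta> (\<eta> x)) u"
  by (simp add: monomial_subst_def poly_subst_prod poly_subst_power)

text \<open>
  This is the source of associativity of \<open>\<star>\<close>: a substitution is a ring homomorphism, and so it
  passes through sums, products and powers to the values that are substituted.
\<close>
lemma poly_subst_poly_subst:
  "poly_subst \<theta> (poly_subst \<eta> p) = poly_subst (\<lambda>x. poly_subst \<theta> (\<eta> x)) p"
  by (simp add: poly_subst_def[of _ p] poly_subst_sum poly_subst_mult poly_subst_monomial_subst)

lemma poly_subst_cong:
  assumes "\<And>g. g \<in> vars p \<Longrightarrow> \<theta> g = \<eta> g"
  shows "poly_subst \<theta> p = poly_subst \<eta> p"
  unfolding poly_subst_def using assms
  by (intro sum.cong arg_cong2[of _ _ _ _ "(*)"] monomial_subst_cong) (auto simp: vars_def)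

text \<open>
  The exponent of the monomial that arises from \<open>X\<^sup>u\<close> by the renaming \<open>X\<^sub>g \<mapsto> X\<^bsub>f g\<^esub>\<close>.  Variables that
  \<open>f\<close> identifies have their exponents added, so that renamings which are injective only on part of the
  variables are covered.
\<close>
definition push :: "('x \<Rightarrow> 'y) \<Rightarrow> ('x \<Rightarrow>\<^sub>0 nat) \<Rightarrow> ('y \<Rightarrow>\<^sub>0 nat)" where
  "push f u = (\<Sum>g\<in>Poly_Mapping.keys u. Poly_Mapping.single (f g) (Poly_Mapping.lookup u g))"

lemma keys_push: "Poly_Mapping.keys (push f u) \<subseteq> f ` Poly_Mapping.keys u"
  unfolding push_def by (rule order.trans[OF keys_sum]) (auto split: if_splits)

lemma lookup_push:
  assumes "inj_on f E" "Poly_Mapping.keys u \<subseteq> E" "g \<in> E"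
  shows "Poly_Mapping.lookup (push f u) (f g) = Poly_Mapping.lookup u g"
proof -
  have "Poly_Mapping.lookup (push f u) (f g) =
      (\<Sum>h\<in>Poly_Mapping.keys u. if h = g then Poly_Mapping.lookup u h else 0)"
    unfolding push_def lookup_sum lookup_single when_def
    by (rule sum.cong) (use assms in \<open>auto dest: inj_onD\<close>)
  also have "\<dots> = Poly_Mapping.lookup u g"
    by (simp add: sum.delta' in_keys_iff)
  finally show ?thesis .
qed

lemma inj_on_push:
  assumes "inj_on f E"
  shows "inj_on (push f) {u. Poly_Mapping.keys u \<subseteq> E}"
proof (rule inj_onI, rule poly_mapping_eqI)
  fix u w g
  assume "u \<in> {u. Poly_Mapping.keys u \<subseteq> E}" "w \<in> {u. Poly_Mapping.keys u \<subseteq> E}" "push f u = push f w"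
  then show "Poly_Mapping.lookup u g = Poly_Mapping.lookup w g"
    using lookup_push[OF assms, of u g] lookup_push[OF assms, of w g]
    by (cases "g \<in> E") (simp_all, metis in_keys_iff subsetD)
qed

lemma var_power: "var g ^ n = Poly_Mapping.single (Poly_Mapping.single g n) 1"
  by (induction n) (simp_all add: var_def mult_single single_add[symmetric])

lemma prod_single:
  "(\<Prod>i\<in>I. Poly_Mapping.single (e i) 1) =
    (Poly_Mapping.single (\<Sum>i\<in>I. e i) 1 :: ('x, 'k::field) near_ring)"
  by (induction I rule: infinite_finite_induct) (simp_all add: mult_single)

lemma monomial_subst_vars:
  "monomial_subst (\<lambda>g. var (f g)) u = Poly_Mapping.single (push f u) 1"
  by (simp add: monomial_subst_def var_power prod_single push_def)

lemma poly_subst_vars: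
  "poly_subst (\<lambda>g. var (f g)) p =
    (\<Sum>u\<in>Poly_Mapping.keys p. Poly_Mapping.single (push f u) (Poly_Mapping.lookup p u))"
  by (simp add: poly_subst_def monomial_subst_vars mult_single)

lemma push_id: "push (\<lambda>g. g) u = u"
  by (rule poly_mapping_eqI) (rule lookup_push[where f = "\<lambda>g. g" and E = UNIV], auto)

lemma monomial_subst_var: "monomial_subst var u = Poly_Mapping.single u 1"
  using monomial_subst_vars[of "\<lambda>g. g" u] by (simp add: push_id)

lemma poly_subst_id: "poly_subst var p = p"
  using poly_subst_vars[of "\<lambda>g. g" p] poly_as_sum[of p] by (simp add: push_id)

lemma keys_poly_subst_vars:
  "Poly_Mapping.keys (poly_subst (\<lambda>g. var (f g)) p) \<subseteq> push f ` Poly_Mapping.keys p"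
  unfolding poly_subst_vars by (rule order.trans[OF keys_sum]) (auto split: if_splits)

lemma vars_poly_subst_vars: "vars (poly_subst (\<lambda>g. var (f g)) p) \<subseteq> f ` vars p"
  using keys_poly_subst_vars[of f p] keys_push[of f] unfolding vars_def by blast

text \<open>
  A renaming that is injective on the variables of \<open>p\<close> maps distinct monomials of \<open>p\<close> to distinct
  monomials, so that no coefficients can cancel.
\<close>
lemma poly_subst_vars_nonzero:
  assumes "inj_on f (vars p)" "p \<noteq> 0"
  shows "poly_subst (\<lambda>g. var (f g)) p \<noteq> 0"
proof -
  obtain u where u: "u \<in> Poly_Mapping.keys p"
    using \<open>p \<noteq> 0\<close> keys_eq_empty by (metis equals0I poly_mapping_eqI lookup_zero in_keys_iff)
  have inj: "inj_on (push f) (Poly_Mapping.keys p)"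
    by (rule inj_on_subset[OF inj_on_push[OF assms(1)]]) (auto simp: vars_def)
  have "Poly_Mapping.lookup (poly_subst (\<lambda>g. var (f g)) p) (push f u) =
      (\<Sum>w\<in>Poly_Mapping.keys p. if w = u then Poly_Mapping.lookup p w else 0)"
    unfolding poly_subst_vars lookup_sum lookup_single when_def
    by (rule sum.cong) (use inj u in \<open>auto dest: inj_onD\<close>)
  also have "\<dots> \<noteq> 0" using u by (simp add: in_keys_iff)
  finally show ?thesis by (metis lookup_zero)
qed

section \<open>The near ring multiplication as substitution\<close>

lemma act_exp_eq_push: "act_exp g u = push (\<lambda>h. g + h) u"
proof (rule poly_mapping_eqI)
  fix h
  have "Poly_Mapping.lookup (push ((+) g) u) (g + (- g + h)) = Poly_Mapping.lookup u (- g + h)"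
    by (rule lookup_push[where E = UNIV]) (auto simp: inj_on_def)
  then show "Poly_Mapping.lookup (act_exp g u) h = Poly_Mapping.lookup (push ((+) g) u) h"
    by (simp add: lookup_act_exp add.assoc[symmetric])
qed

lemma act_eq_poly_subst: "act g \<gamma> = poly_subst (\<lambda>h. var (g + h)) \<gamma>"
  by (simp add: act_def poly_subst_vars act_exp_eq_push)

lemma star_eq_poly_subst: "\<alpha> \<star> \<beta> = poly_subst (\<lambda>g. act g \<beta>) \<alpha>"
  by (simp add: star_def poly_subst_def monomial_subst_def)

lemma act_star: "act g (\<alpha> \<star> \<beta>) = poly_subst (\<lambda>h. act (g + h) \<beta>) \<alpha>"
  by (simp add: star_eq_poly_subst act_eq_poly_subst poly_subst_poly_subst add.assoc)

text \<open>
  Both sides are the result of substituting in \<open>\<alpha>\<close>; the values agree because \<open>g\<close> acts on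
  \<open>\<beta> \<star> \<gamma>\<close> by shifting the values that are substituted in \<open>\<beta>\<close>.
\<close>
lemma star_assoc: "(\<alpha> \<star> \<beta>) \<star> \<gamma> = \<alpha> \<star> (\<beta> \<star> \<gamma>)"
proof -
  have "poly_subst (\<lambda>g. act g \<gamma>) (act h \<beta>) = act h (\<beta> \<star> \<gamma>)" for h
    by (subst act_star) (simp add: act_eq_poly_subst[of h] poly_subst_poly_subst)
  then show ?thesis
    by (simp add: star_eq_poly_subst[of _ \<gamma>] star_eq_poly_subst[of \<alpha>] poly_subst_poly_subst)
qed

lemma var_0_star: "var 0 \<star> \<beta> = \<beta>"
  by (simp add: star_eq_poly_subst act_eq_poly_subst poly_subst_id)

lemma star_var_0: "\<alpha> \<star> var 0 = \<alpha>"
  by (simp add: star_eq_poly_subst act_eq_poly_subst poly_subst_id)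

lemma star_diff_left: "(\<alpha> - \<beta>) \<star> \<gamma> = \<alpha> \<star> \<gamma> - \<beta> \<star> \<gamma>"
  by (simp add: star_eq_poly_subst poly_subst_diff)


section \<open>Relations in disjoint variables lower the dimension\<close>

global_interpretation polynomials: vector_space
  "\<lambda>c (p :: ('x, 'k::field) near_ring). Poly_Mapping.single 0 c * p"
  by unfold_locales
     (simp_all add: algebra_simps single_add mult_single flip: mult.assoc)

lemma independent_monomials:
  fixes U :: "('x \<Rightarrow>\<^sub>0 nat) set"
  assumes "finite U"
  shows "polynomials.independent ((\<lambda>u. Poly_Mapping.single u (1::'k::field)) ` U)"
proof (rule polynomials.independent_if_scalars_zero)
  fix f :: "('x, 'k) near_ring \<Rightarrow> 'k" and p :: "('x, 'k) near_ring"
  assume comb: "(\<Sum>p\<in>(\<lambda>u. Poly_Mapping.single u 1) ` U. Poly_Mapping.single 0 (f p) * p) = 0"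
  assume "p \<in> (\<lambda>u. Poly_Mapping.single u 1) ` U"
  then obtain w where w: "w \<in> U" "p = Poly_Mapping.single w 1" by auto
  have inj: "inj_on (\<lambda>u. Poly_Mapping.single u (1::'k)) U"
    by (rule inj_onI) (metis lookup_single_eq lookup_single_not_eq zero_neq_one)
  have "0 = Poly_Mapping.lookup
      (\<Sum>u\<in>U. Poly_Mapping.single u (f (Poly_Mapping.single u 1))) w"
    using comb by (simp add: sum.reindex[OF inj] mult_single o_def)
  also have "\<dots> = (\<Sum>u\<in>U. if u = w then f (Poly_Mapping.single u 1) else 0)"
    by (simp add: lookup_sum lookup_single when_def)
  also have "\<dots> = f p" using w assms by simp
  finally show "f p = 0" by simp
qed (use assms in simp)

lemma poly_subst_in_span:
  "poly_subst \<theta> p \<in> polynomials.span (monomial_subst \<theta> ` Poly_Mapping.keys p)"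
  unfolding poly_subst_def
  by (intro polynomials.span_sum polynomials.span_scale polynomials.span_base) simp

definition total_degree :: "('x \<Rightarrow>\<^sub>0 nat) \<Rightarrow> nat" where
  "total_degree u = (\<Sum>x\<in>Poly_Mapping.keys u. Poly_Mapping.lookup u x)"

lemma total_degree_superset:
  assumes "finite U" "Poly_Mapping.keys u \<subseteq> U"
  shows "total_degree u = (\<Sum>x\<in>U. Poly_Mapping.lookup u x)"
  unfolding total_degree_def
  by (rule sum.mono_neutral_left) (use assms in \<open>auto simp: in_keys_iff\<close>)

lemma total_degree_add: "total_degree (u + w) = total_degree u + total_degree w"
proof -
  let ?U = "Poly_Mapping.keys u \<union> Poly_Mapping.keys w"
  have "Poly_Mapping.keys (u + w) \<subseteq> ?U" by (rule Poly_Mapping.keys_add)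
  then show ?thesis
    by (simp add: total_degree_superset[of ?U] lookup_add sum.distrib)
qed

lemma lookup_le_total_degree: "Poly_Mapping.lookup u x \<le> total_degree u"
  unfolding total_degree_def
  by (cases "x \<in> Poly_Mapping.keys u") (auto simp: in_keys_iff intro!: member_le_sum)

definition exponents :: "'x set \<Rightarrow> nat \<Rightarrow> ('x \<Rightarrow>\<^sub>0 nat) set" where
  "exponents V m = {u. Poly_Mapping.keys u \<subseteq> V \<and> total_degree u \<le> m}"

text \<open>
  Exponents supported in a finite set \<open>V\<close> are the same as functions on \<open>V\<close>, so that sets of exponents
  given by independent conditions on the coordinates are counted by \<open>card_PiE\<close>.
\<close>
lemma bij_betw_lookup_PiE:
  assumes "finite V"
  shows "bij_betw (\<lambda>u. restrict (Poly_Mapping.lookup u) V)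
    {u. Poly_Mapping.keys u \<subseteq> V \<and> (\<forall>v\<in>V. Poly_Mapping.lookup u v \<in> R v)} (PiE V R)"
  (is "bij_betw ?f ?A _")
proof (rule bij_betwI')
  fix u w assume "u \<in> ?A" "w \<in> ?A"
  then have "u = w" if "?f u = ?f w"
    using that
    by (intro poly_mapping_eqI)
       (metis (mono_tags, lifting) in_keys_iff mem_Collect_eq restrict_apply' subsetD)
  then show "(?f u = ?f w) = (u = w)" by blast
next
  fix f assume f: "f \<in> PiE V R"
  let ?u = "Abs_poly_mapping (\<lambda>v. if v \<in> V then f v else 0)"
  have "finite {v. (if v \<in> V then f v else 0) \<noteq> 0}"
    by (rule finite_subset[OF _ assms]) auto
  then have l: "Poly_Mapping.lookup ?u = (\<lambda>v. if v \<in> V then f v else 0)" by simp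
  have "?f ?u = f" using f by (auto simp: l fun_eq_iff PiE_def extensional_def)
  moreover have "?u \<in> ?A" using f by (auto simp: l in_keys_iff split: if_splits)
  ultimately show "\<exists>u\<in>?A. f = ?f u" by (intro bexI[of _ ?u]) (simp only:)
next
  fix u assume "u \<in> ?A"
  then show "?f u \<in> PiE V R" by simp
qed

lemma card_exponents_box:
  assumes "finite V"
  shows "card {u. Poly_Mapping.keys u \<subseteq> V \<and> (\<forall>v\<in>V. Poly_Mapping.lookup u v \<in> R v)} =
    (\<Prod>v\<in>V. card (R v))"
  using bij_betw_same_card[OF bij_betw_lookup_PiE[OF assms, of R]] card_PiE[OF assms, of R] by simp

lemma finite_exponents_box:
  assumes "finite V" "\<And>v. v \<in> V \<Longrightarrow> finite (R v)"
  shows "finite {u. Poly_Mapping.keys u \<subseteq> V \<and> (\<forall>v\<in>V. Poly_Mapping.lookup u v \<in> R v)}"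
  using bij_betw_finite[OF bij_betw_lookup_PiE[OF assms(1), of R]] finite_PiE[OF assms] by simp

lemma finite_exponents:
  assumes "finite V"
  shows "finite (exponents V m)"
  by (rule finite_subset[OF _ finite_exponents_box[OF assms, of "\<lambda>_. {..m}"]])
     (auto simp: exponents_def intro: order.trans[OF lookup_le_total_degree])

lemma keys_mult_exponents:
  assumes "Poly_Mapping.keys p \<subseteq> exponents V a" "Poly_Mapping.keys q \<subseteq> exponents V b"
  shows "Poly_Mapping.keys (p * q) \<subseteq> exponents V (a + b)"
proof
  fix u assume "u \<in> Poly_Mapping.keys (p * q)"
  then obtain v w where "u = v + w" "v \<in> exponents V a" "w \<in> exponents V b"
    using keys_mult[of p q] assms by blast
  then show "u \<in> exponents V (a + b)"
    using Poly_Mapping.keys_add[of v w] by (auto simp: exponents_def total_degree_add)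
qed

lemma keys_power_exponents:
  assumes "Poly_Mapping.keys p \<subseteq> exponents V a"
  shows "Poly_Mapping.keys (p ^ n) \<subseteq> exponents V (n * a)"
proof (induction n)
  case 0
  then show ?case by (simp add: exponents_def total_degree_def)
next
  case (Suc n)
  then show ?case using keys_mult_exponents[OF assms Suc] by simp
qed

lemma keys_prod_exponents:
  assumes "\<And>i. i \<in> I \<Longrightarrow> Poly_Mapping.keys (p i) \<subseteq> exponents V (a i)"
  shows "Poly_Mapping.keys (\<Prod>i\<in>I. p i) \<subseteq> exponents V (\<Sum>i\<in>I. a i)"
  using assms
proof (induction I rule: infinite_finite_induct)
  case (insert i I)
  then show ?case
    using keys_mult_exponents[of "p i" V "a i" "prod p I" "sum a I"] by simp
qed (simp_all add: exponents_def total_degree_def)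

text \<open>
  The leading exponent for the graded order: total degree first, with ties resolved by the
  lexicographic order on \<^typ>\<open>'x \<Rightarrow>\<^sub>0 nat\<close>.  The grading is needed to keep total degrees bounded during
  division; the second component makes the order total and compatible with addition.
\<close>
definition leading :: "('x::linorder, 'k::field) near_ring \<Rightarrow> ('x \<Rightarrow>\<^sub>0 nat) \<Rightarrow> bool" where
  "leading p \<mu> \<longleftrightarrow> \<mu> \<in> Poly_Mapping.keys p \<and> (\<forall>u\<in>Poly_Mapping.keys p. u \<noteq> \<mu> \<longrightarrow>
     total_degree u < total_degree \<mu> \<or> total_degree u = total_degree \<mu> \<and> u < \<mu>)"

lemma leading_exists:
  fixes p :: "('x::linorder, 'k::field) near_ring"
  assumes "p \<noteq> 0"
  shows "\<exists>\<mu>. leading p \<mu>"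
proof -
  let ?K = "Poly_Mapping.keys p"
  have K: "?K \<noteq> {}" using assms by (metis in_keys_iff empty_iff lookup_zero poly_mapping_eqI)
  let ?t = "Max (total_degree ` ?K)"
  let ?L = "{u \<in> ?K. total_degree u = ?t}"
  have "?t \<in> total_degree ` ?K" using K by (intro Max_in) auto
  then have "Max ?L \<in> ?L" by (intro Max_in) auto
  moreover have "u \<le> Max ?L" if "u \<in> ?L" for u using that by (intro Max_ge) auto
  moreover have "total_degree u \<le> ?t" if "u \<in> ?K" for u using that by (intro Max_ge) auto
  ultimately have "leading p (Max ?L)"
    unfolding leading_def by (smt (verit, best) mem_Collect_eq order_le_less)
  then show ?thesis ..
qed

text \<open>
  The standard monomials of degree at most \<open>m\<close>: those that survive division by polynomials whose leading
  exponents form the set \<open>M\<close>.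
\<close>
definition standard :: "('x \<Rightarrow>\<^sub>0 nat) set \<Rightarrow> 'x set \<Rightarrow> nat \<Rightarrow> ('x \<Rightarrow>\<^sub>0 nat) set" where
  "standard M V m = {u \<in> exponents V m. \<forall>\<mu>\<in>M. \<forall>w. u \<noteq> \<mu> + w}"

text \<open>
  One division step: a relation \<open>Q\<close>, multiplied by the monomial with exponent \<open>w\<close>, is solved for the
  term with exponent \<open>\<mu> + w\<close>.
\<close>
lemma monomial_subst_reduce:
  fixes Q :: "('x, 'k::field) near_ring" and \<theta> :: "'x \<Rightarrow> ('y, 'k) near_ring"
  assumes "poly_subst \<theta> Q = 0" "\<mu> \<in> Poly_Mapping.keys Q"
  shows "monomial_subst \<theta> (\<mu> + w) \<in>
    polynomials.span ((\<lambda>u. monomial_subst \<theta> (u + w)) ` (Poly_Mapping.keys Q - {\<mu>}))"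
proof -
  let ?c = "Poly_Mapping.lookup Q"
  let ?R = "\<Sum>u\<in>Poly_Mapping.keys Q - {\<mu>}. Poly_Mapping.single 0 (?c u) * monomial_subst \<theta> (u + w)"
  have "0 = poly_subst \<theta> Q * monomial_subst \<theta> w" using assms(1) by simp
  also have "\<dots> = (\<Sum>u\<in>Poly_Mapping.keys Q. Poly_Mapping.single 0 (?c u) * monomial_subst \<theta> (u + w))"
    by (simp add: poly_subst_def sum_distrib_right monomial_subst_add mult.assoc)
  also have "\<dots> = Poly_Mapping.single 0 (?c \<mu>) * monomial_subst \<theta> (\<mu> + w) + ?R"
    by (rule sum.remove) (use assms(2) in auto)
  finally have "Poly_Mapping.single 0 (?c \<mu>) * monomial_subst \<theta> (\<mu> + w) = - ?R"
    by (simp add: eq_neg_iff_add_eq_0)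
  then have "Poly_Mapping.single 0 (inverse (?c \<mu>)) *
      (Poly_Mapping.single 0 (?c \<mu>) * monomial_subst \<theta> (\<mu> + w)) =
      Poly_Mapping.single 0 (inverse (?c \<mu>)) * (- ?R)" by simp
  moreover have "Poly_Mapping.single 0 (inverse (?c \<mu>)) *
      (Poly_Mapping.single 0 (?c \<mu>) * monomial_subst \<theta> (\<mu> + w)) = monomial_subst \<theta> (\<mu> + w)"
    using assms(2) by (simp add: mult.assoc[symmetric] mult_single in_keys_iff)
  ultimately have "monomial_subst \<theta> (\<mu> + w) = Poly_Mapping.single 0 (inverse (?c \<mu>)) * (- ?R)"
    by simp
  also have "\<dots> \<in> polynomials.span
      ((\<lambda>u. monomial_subst \<theta> (u + w)) ` (Poly_Mapping.keys Q - {\<mu>}))"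
    by (intro polynomials.span_scale polynomials.span_neg polynomials.span_sum polynomials.span_base) simp
  finally show ?thesis .
qed

text \<open>
  Multivariate division.  A monomial that is least, in the graded order, among those of degree at most
  \<open>m\<close> for which the claim fails is not standard, so one division step writes its value in terms of the
  values of smaller monomials; these still have degree at most \<open>m\<close>.
\<close>
lemma span_standard_monomials:
  fixes Q :: "'s \<Rightarrow> ('x::linorder, 'k::field) near_ring" and \<theta> :: "'x \<Rightarrow> ('y, 'k) near_ring"
  assumes "finite V"
    and Q: "\<And>s. s \<in> S \<Longrightarrow> poly_subst \<theta> (Q s) = 0" "\<And>s. s \<in> S \<Longrightarrow> leading (Q s) (\<mu> s)"
      "\<And>s. s \<in> S \<Longrightarrow> vars (Q s) \<subseteq> V"
    and "u \<in> exponents V m"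
  shows "monomial_subst \<theta> u \<in> polynomials.span (monomial_subst \<theta> ` standard (\<mu> ` S) V m)"
    (is "_ \<in> ?W")
proof (rule ccontr)
  assume "monomial_subst \<theta> u \<notin> ?W"
  define B where "B = {u \<in> exponents V m. monomial_subst \<theta> u \<notin> ?W}"
  have "finite B" using finite_exponents[OF \<open>finite V\<close>] by (simp add: B_def)
  have "B \<noteq> {}" using \<open>monomial_subst \<theta> u \<notin> ?W\<close> \<open>u \<in> _\<close> by (auto simp: B_def)
  let ?t = "Min (total_degree ` B)"
  let ?L = "{u \<in> B. total_degree u = ?t}"
  have "?t \<in> total_degree ` B" using \<open>B \<noteq> {}\<close> \<open>finite B\<close> by (intro Min_in) auto
  then have x: "Min ?L \<in> ?L" using \<open>finite B\<close> by (intro Min_in) auto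
  define x where "x = Min ?L"
  have xB: "x \<in> B" using x by (simp add: x_def)
  have least: "y \<notin> B" if "total_degree y < total_degree x \<or> total_degree y = total_degree x \<and> y < x" for y
  proof
    assume "y \<in> B"
    then have "?t \<le> total_degree y" using \<open>finite B\<close> by (intro Min_le) auto
    moreover have "total_degree x = ?t" using x by (simp add: x_def)
    ultimately have "y \<in> ?L" "y < x" using that \<open>y \<in> B\<close> by auto
    moreover have "x \<le> y" unfolding x_def using \<open>finite B\<close> \<open>y \<in> ?L\<close> by (intro Min_le) auto
    ultimately show False by simp
  qed
  have "x \<notin> standard (\<mu> ` S) V m" using xB by (auto simp: B_def intro: polynomials.span_base)
  moreover have xE: "x \<in> exponents V m" using xB by (simp add: B_def)
  ultimately obtain s w where s: "s \<in> S" and xw: "x = \<mu> s + w" by (auto simp: standard_def)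
  have "Poly_Mapping.keys w \<subseteq> Poly_Mapping.keys x" by (auto simp: xw in_keys_iff lookup_add)
  then have w: "Poly_Mapping.keys w \<subseteq> V" using xE by (auto simp: exponents_def)
  have "monomial_subst \<theta> (v + w) \<in> ?W" if v: "v \<in> Poly_Mapping.keys (Q s) - {\<mu> s}" for v
  proof -
    have lt: "total_degree (v + w) < total_degree x \<or> total_degree (v + w) = total_degree x \<and> v + w < x"
      using Q(2)[OF s] v by (auto simp: leading_def xw total_degree_add intro: add_strict_right_mono)
    have "Poly_Mapping.keys (v + w) \<subseteq> V"
      using Poly_Mapping.keys_add[of v w] w Q(3)[OF s] v by (auto simp: vars_def)
    then have "v + w \<in> exponents V m" using lt xE by (auto simp: exponents_def)
    then show ?thesis using least[OF lt] by (simp add: B_def)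
  qed
  then have "polynomials.span ((\<lambda>u. monomial_subst \<theta> (u + w)) ` (Poly_Mapping.keys (Q s) - {\<mu> s})) \<subseteq> ?W"
    by (intro polynomials.span_minimal polynomials.subspace_span) auto
  moreover have "\<mu> s \<in> Poly_Mapping.keys (Q s)" using Q(2)[OF s] by (simp add: leading_def)
  ultimately have "monomial_subst \<theta> x \<in> ?W"
    using monomial_subst_reduce[OF Q(1)[OF s]] unfolding xw by blast
  then show False using xB by (simp add: B_def)
qed

text \<open>
  The exponent of a standard monomial is smaller than \<open>\<mu> s\<close>, hence smaller than \<open>L\<close>, at some variable
  from each of the disjoint supports.  So there are \<open>card S\<close> variables in which the exponent takes at most
  \<open>L\<close> values, independently of \<open>m\<close>, and the factor \<open>2 ^ card V\<close> bounds the number of choices of these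
  variables.
\<close>
lemma card_standard_le:
  assumes "finite V" "finite S" "disjoint_family_on (\<lambda>s. Poly_Mapping.keys (\<mu> s)) S"
    and "\<And>s. s \<in> S \<Longrightarrow> Poly_Mapping.keys (\<mu> s) \<subseteq> V"
    and "\<And>s. s \<in> S \<Longrightarrow> total_degree (\<mu> s) \<le> L"
  shows "card (standard (\<mu> ` S) V m) \<le> 2 ^ card V * (L ^ card S * (m + 1) ^ (card V - card S))"
    and "standard (\<mu> ` S) V m \<noteq> {} \<Longrightarrow> card S \<le> card V"
proof -
  define box where "box T = {u. Poly_Mapping.keys u \<subseteq> V \<and>
    (\<forall>v\<in>V. Poly_Mapping.lookup u v \<in> (if v \<in> T then {..<L} else {..m}))}" for T
  define \<T> where "\<T> = {T. T \<subseteq> V \<and> card T = card S}"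
  have "finite \<T>" using \<open>finite V\<close> by (simp add: \<T>_def)
  have "\<exists>T\<in>\<T>. u \<in> box T" if u: "u \<in> standard (\<mu> ` S) V m" for u
  proof -
    have "\<exists>v. Poly_Mapping.lookup u v < Poly_Mapping.lookup (\<mu> s) v" if s: "s \<in> S" for s
    proof (rule ccontr)
      assume "\<not> ?thesis"
      then have "u = \<mu> s + (u - \<mu> s)"
        by (intro poly_mapping_eqI) (simp add: lookup_add lookup_minus not_less)
      then show False using u s unfolding standard_def by blast
    qed
    then obtain c where c: "\<And>s. s \<in> S \<Longrightarrow> Poly_Mapping.lookup u (c s) < Poly_Mapping.lookup (\<mu> s) (c s)"
      by metis
    have key: "c s \<in> Poly_Mapping.keys (\<mu> s)" if "s \<in> S" for s
      using c[OF that] by (simp add: in_keys_iff)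
    have "inj_on c S"
      using assms(3) key by (auto simp: inj_on_def disjoint_family_on_def) (metis disjoint_iff)
    then have "c ` S \<in> \<T>" using key assms(4) by (auto simp: \<T>_def card_image)
    moreover have "Poly_Mapping.lookup u (c s) < L" if "s \<in> S" for s
      using c[OF that] lookup_le_total_degree[of "\<mu> s" "c s"] assms(5)[OF that] by linarith
    moreover have "Poly_Mapping.lookup u v \<le> m" for v
      using u lookup_le_total_degree[of u v] by (auto simp: standard_def exponents_def)
    ultimately show ?thesis
      using u by (intro bexI[of _ "c ` S"]) (auto simp: box_def standard_def exponents_def)
  qed
  then have sub: "standard (\<mu> ` S) V m \<subseteq> (\<Union>T\<in>\<T>. box T)" by blast
  show "card S \<le> card V" if "standard (\<mu> ` S) V m \<noteq> {}"
  proof -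
    obtain T where "T \<in> \<T>" using sub \<open>standard _ _ _ \<noteq> {}\<close> by blast
    then show ?thesis using card_mono[OF \<open>finite V\<close>, of T] by (simp add: \<T>_def)
  qed
  have card_box: "card (box T) = L ^ card S * (m + 1) ^ (card V - card S)" if "T \<in> \<T>" for T
  proof -
    have T: "T \<subseteq> V" "card T = card S" "finite T"
      using that \<open>finite V\<close> finite_subset by (auto simp: \<T>_def)
    have "card (box T) = (\<Prod>v\<in>V. if v \<in> T then L else m + 1)"
      unfolding box_def card_exponents_box[OF \<open>finite V\<close>] by (rule prod.cong) auto
    also have "\<dots> = L ^ card T * (m + 1) ^ card (V - T)"
      using T \<open>finite V\<close> by (simp add: prod.If_cases Int_absorb1 Diff_eq)
    finally show ?thesis using T by (simp add: card_Diff_subset)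
  qed
  have "finite (box T)" for T
    unfolding box_def by (rule finite_exponents_box[OF \<open>finite V\<close>]) simp
  then have "card (standard (\<mu> ` S) V m) \<le> card (\<Union>T\<in>\<T>. box T)"
    using sub \<open>finite \<T>\<close> by (intro card_mono) auto
  also have "\<dots> \<le> (\<Sum>T\<in>\<T>. card (box T))" by (rule card_UN_le[OF \<open>finite \<T>\<close>])
  also have "\<dots> = card \<T> * (L ^ card S * (m + 1) ^ (card V - card S))" by (simp add: card_box)
  also have "\<dots> \<le> 2 ^ card V * (L ^ card S * (m + 1) ^ (card V - card S))"
  proof (rule mult_right_mono)
    have "card \<T> \<le> card (Pow V)" using \<open>finite V\<close> by (intro card_mono) (auto simp: \<T>_def)
    then show "card \<T> \<le> 2 ^ card V" by (simp add: card_Pow \<open>finite V\<close>)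
  qed simp
  finally show "card (standard (\<mu> ` S) V m) \<le> 2 ^ card V * (L ^ card S * (m + 1) ^ (card V - card S))" .
qed

lemma exponent_le_of_power_bound:
  fixes a r C D :: nat
  assumes "\<And>d. (d + 1) ^ a \<le> C * (D * d + 1) ^ r"
  shows "a \<le> r"
proof (rule ccontr)
  assume "\<not> a \<le> r"
  define d where "d = C * (D + 1) ^ r"
  have "(d + 1) ^ Suc r \<le> (d + 1) ^ a"
    using \<open>\<not> a \<le> r\<close> by (intro power_increasing) auto
  also have "\<dots> \<le> C * (D * d + 1) ^ r" by (rule assms)
  also have "\<dots> \<le> C * ((D + 1) * (d + 1)) ^ r"
    by (intro mult_left_mono power_mono) auto
  also have "\<dots> = d * (d + 1) ^ r" by (simp only: power_mult_distrib d_def mult.assoc)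
  finally have "(d + 1) * (d + 1) ^ r \<le> d * (d + 1) ^ r" by simp
  then show False by simp
qed

text \<open>
  If the algebra generated by the values of \<open>\<theta>\<close> on \<open>V\<close> contains the variables in \<open>T\<close>, its transcendence
  degree is at least \<open>card T\<close>; each relation, being in variables of its own, lowers the transcendence
  degree from \<open>card V\<close> by at least one.  The proof compares the growth of two counts of monomials instead of using
  transcendence degrees.
\<close>
lemma card_generated_plus_relations_le:
  fixes \<theta> :: "'x::linorder \<Rightarrow> ('x, 'k::field) near_ring"
    and A :: "'x \<Rightarrow> ('x, 'k) near_ring" and Q :: "'s \<Rightarrow> ('x, 'k) near_ring"
  assumes "finite V" "finite S" "T \<subseteq> V"
    and A: "\<And>v. v \<in> T \<Longrightarrow> poly_subst \<theta> (A v) = var v" "\<And>v. v \<in> T \<Longrightarrow> vars (A v) \<subseteq> V"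
    and Q: "\<And>s. s \<in> S \<Longrightarrow> poly_subst \<theta> (Q s) = 0" "\<And>s. s \<in> S \<Longrightarrow> Q s \<noteq> 0"
      "\<And>s. s \<in> S \<Longrightarrow> vars (Q s) \<subseteq> V"
    and disj: "disjoint_family_on (\<lambda>s. vars (Q s)) S"
  shows "card T + card S \<le> card V"
proof -
  have "finite T" using assms finite_subset by blast
  have "\<forall>s\<in>S. \<exists>m. leading (Q s) m" using leading_exists Q(2) by blast
  from bchoice[OF this] obtain \<mu> where \<mu>: "\<And>s. s \<in> S \<Longrightarrow> leading (Q s) (\<mu> s)"
    by blast
  have \<mu>_vars: "Poly_Mapping.keys (\<mu> s) \<subseteq> vars (Q s)" if "s \<in> S" for s
    using \<mu>[OF that] by (auto simp: leading_def vars_def)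
  have disj\<mu>: "disjoint_family_on (\<lambda>s. Poly_Mapping.keys (\<mu> s)) S"
    using disj \<mu>_vars unfolding disjoint_family_on_def by blast
  have \<mu>V: "Poly_Mapping.keys (\<mu> s) \<subseteq> V" if "s \<in> S" for s
    using \<mu>_vars[OF that] Q(3)[OF that] by blast
  define L where "L = (\<Sum>s\<in>S. total_degree (\<mu> s))"
  have L: "total_degree (\<mu> s) \<le> L" if "s \<in> S" for s
    unfolding L_def using that \<open>finite S\<close> by (intro member_le_sum) auto
  define D where "D v = (\<Sum>u\<in>Poly_Mapping.keys (A v). total_degree u)" for v
  have D: "Poly_Mapping.keys (A v) \<subseteq> exponents V (D v)" if "v \<in> T" for v
    using A(2)[OF that] by (auto simp: exponents_def D_def vars_def intro!: member_le_sum)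
  let ?D = "\<Sum>v\<in>T. D v"
  let ?St = "\<lambda>m. standard (\<mu> ` S) V m"
  \<comment> \<open>A monomial in the variables from \<open>T\<close> is the value at \<open>\<theta>\<close> of a product of polynomials
    \<open>A v\<close>, and this product has degree linear in \<open>d\<close>; the value is then reduced to standard monomials.\<close>
  have lower: "(d + 1) ^ card T \<le> card (?St (?D * d))" for d
  proof -
    define U where "U = {u. Poly_Mapping.keys u \<subseteq> T \<and> (\<forall>v\<in>T. Poly_Mapping.lookup u v \<in> {..d})}"
    have "finite U" unfolding U_def by (rule finite_exponents_box[OF \<open>finite T\<close>]) simp
    let ?W = "polynomials.span (monomial_subst \<theta> ` ?St (?D * d))"
    have "Poly_Mapping.single u 1 \<in> ?W" if u: "u \<in> U" for u
    proof -
      have uT: "Poly_Mapping.keys u \<subseteq> T" using u by (simp add: U_def)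
      have "Poly_Mapping.keys (monomial_subst A u) \<subseteq>
          exponents V (\<Sum>v\<in>T. Poly_Mapping.lookup u v * D v)"
        unfolding monomial_subst_superset[OF \<open>finite T\<close> uT]
        by (intro keys_prod_exponents keys_power_exponents D)
      also have "\<dots> \<subseteq> exponents V (?D * d)"
      proof -
        have "(\<Sum>v\<in>T. Poly_Mapping.lookup u v * D v) \<le> (\<Sum>v\<in>T. d * D v)"
          using u by (intro sum_mono mult_right_mono) (auto simp: U_def)
        then show ?thesis by (auto simp: exponents_def sum_distrib_left[symmetric] mult.commute)
      qed
      finally have keys: "Poly_Mapping.keys (monomial_subst A u) \<subseteq> exponents V (?D * d)" .
      have "Poly_Mapping.single u 1 = monomial_subst (\<lambda>v. poly_subst \<theta> (A v)) u"
        unfolding monomial_subst_var[symmetric]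
        by (rule monomial_subst_cong) (use A(1) uT in auto)
      also have "\<dots> = poly_subst \<theta> (monomial_subst A u)"
        by (simp add: poly_subst_monomial_subst)
      also have "\<dots> \<in> polynomials.span (monomial_subst \<theta> ` Poly_Mapping.keys (monomial_subst A u))"
        by (rule poly_subst_in_span)
      also have "\<dots> \<subseteq> ?W"
      proof (intro polynomials.span_minimal polynomials.subspace_span image_subsetI)
        fix w assume "w \<in> Poly_Mapping.keys (monomial_subst A u)"
        then show "monomial_subst \<theta> w \<in> ?W"
          by (intro span_standard_monomials[OF \<open>finite V\<close> Q(1) \<mu> Q(3)]) (use keys in auto)
      qed
      finally show ?thesis .
    qed
    then have sub: "(\<lambda>u. Poly_Mapping.single u 1) ` U \<subseteq> ?W" by blast
    have fin: "finite (?St (?D * d))"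
      using finite_exponents[OF \<open>finite V\<close>] by (simp add: standard_def)
    have "inj_on (\<lambda>u. Poly_Mapping.single u (1::'k)) U"
      by (rule inj_onI) (metis lookup_single_eq lookup_single_not_eq zero_neq_one)
    then have "card U = card ((\<lambda>u. Poly_Mapping.single u (1::'k)) ` U)" by (simp add: card_image)
    also have "\<dots> \<le> card (monomial_subst \<theta> ` ?St (?D * d))"
      using polynomials.independent_span_bound[OF _ independent_monomials[OF \<open>finite U\<close>] sub] fin by simp
    also have "\<dots> \<le> card (?St (?D * d))" by (rule card_image_le[OF fin])
    finally show ?thesis
      unfolding U_def card_exponents_box[OF \<open>finite T\<close>] by simp
  qed
  note upper = card_standard_le[OF \<open>finite V\<close> \<open>finite S\<close> disj\<mu> \<mu>V L]
  have "card T \<le> card V - card S"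
  proof (rule exponent_le_of_power_bound)
    fix d
    show "(d + 1) ^ card T \<le> 2 ^ card V * L ^ card S * (?D * d + 1) ^ (card V - card S)"
      using order.trans[OF lower[of d] upper(1)] by (simp add: mult.assoc)
  qed
  moreover have "card S \<le> card V"
  \<comment> \<open>For \<open>d = 0\<close>, the bound \<open>lower\<close> says that there is a standard monomial.\<close>
  proof (rule upper(2))
    show "?St (?D * 0) \<noteq> {}" using lower[of 0] by auto
  qed
  ultimately show ?thesis by simp
qed


section \<open>Finite models of a sofic group\<close>

text \<open>
  The points of \<open>H\<close> are those at which none of the finitely many conditions on \<open>\<phi>\<close> is violated.  Since
  \<open>g(X\<^sub>h) = X\<^bsub>gh\<^esub>\<close> has the group element \<open>g\<close> on the left, composing two substitutions requires a right
  action; it is obtained as \<open>\<psi> g = \<phi> (- g)\<close>.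
\<close>
lemma sofic_finite_model:
  fixes E :: "'g::group_add set" and \<delta> :: real
  assumes "sofic TYPE('g)" "finite E" "0 \<in> E" "\<delta> > 0"
  obtains n :: nat and \<psi> :: "'g \<Rightarrow> nat \<Rightarrow> nat" and H :: "nat set"
  where "n \<ge> 1" "\<forall>g. \<psi> g permutes {..<n}"
    "H \<subseteq> {..<n}" "real (card H) \<ge> (1 - \<delta>) * real n"
    "\<forall>v\<in>H. \<forall>g\<in>E. \<forall>h\<in>E. \<psi> h (\<psi> g v) = \<psi> (g + h) v"
    "\<forall>v\<in>H. inj_on (\<lambda>g. \<psi> g v) E"
    "\<forall>v\<in>H. \<psi> 0 v = v"
proof -
  define F where "F = uminus ` E"
  have F: "finite F" "F \<noteq> {}" using assms by (auto simp: F_def)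
  \<comment> \<open>For each of the \<open>card (F \<times> F)\<close> pairs, two conditions may each fail on a proportion \<open>\<epsilon>\<close> of the points.\<close>
  define \<epsilon> where "\<epsilon> = \<delta> / (2 * real (card (F \<times> F)))"
  have pos: "real (card (F \<times> F)) > 0" using F by (simp add: card_gt_0_iff)
  then have "\<epsilon> > 0" using \<open>\<delta> > 0\<close> by (simp add: \<epsilon>_def)
  then obtain n \<phi> where n: "n \<ge> 1" and perm: "\<And>g. \<phi> g permutes {..<n}"
    and mult: "\<And>g h. g \<in> F \<Longrightarrow> h \<in> F \<Longrightarrow> hamming_dist n (\<phi> (g + h)) (\<phi> g \<circ> \<phi> h) \<le> \<epsilon>"
    and sep: "\<And>g h. g \<in> F \<Longrightarrow> h \<in> F \<Longrightarrow> g \<noteq> h \<Longrightarrow> hamming_dist n (\<phi> g) (\<phi> h) \<ge> 1 - \<epsilon>"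
    using assms(1) F(1) unfolding sofic_def by metis
  \<comment> \<open>The points where multiplicativity fails, and those where two distinct elements are not
    separated.\<close>
  define M where "M p = {i \<in> {..<n}. \<phi> (fst p + snd p) i \<noteq> \<phi> (fst p) (\<phi> (snd p) i)}" for p
  define N where "N p = {i \<in> {..<n}. fst p \<noteq> snd p \<and> \<phi> (fst p) i = \<phi> (snd p) i}" for p
  define B where "B = (\<Union>p\<in>F \<times> F. M p \<union> N p)"
  have M: "real (card (M p)) \<le> \<epsilon> * n" if "p \<in> F \<times> F" for p
    using mult[of "fst p" "snd p"] that n
    by (auto simp: M_def hamming_dist_def divide_le_eq)
  have N: "real (card (N p)) \<le> \<epsilon> * n" if p: "p \<in> F \<times> F" for p
  proof (cases "fst p = snd p")
    case False
    let ?D = "{i \<in> {..<n}. \<phi> (fst p) i \<noteq> \<phi> (snd p) i}"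
    have "(1 - \<epsilon>) * n \<le> card ?D"
      using sep[of "fst p" "snd p"] p False n by (auto simp: hamming_dist_def le_divide_eq)
    moreover have "?D \<union> N p = {..<n}" "?D \<inter> N p = {}" using False by (auto simp: N_def)
    then have "card ?D + card (N p) = n"
      using card_Un_disjoint[of ?D "N p"] by (simp add: N_def)
    then have "real (card ?D) + real (card (N p)) = n" by (simp flip: of_nat_add)
    ultimately show ?thesis by (simp add: algebra_simps)
  qed (use \<open>\<epsilon> > 0\<close> in \<open>simp add: N_def\<close>)
  have "real (card B) \<le> (\<Sum>p\<in>F \<times> F. real (card (M p \<union> N p)))"
    unfolding B_def of_nat_sum[symmetric] of_nat_le_iff using F by (intro card_UN_le) simp
  also have "\<dots> \<le> (\<Sum>p\<in>F \<times> F. 2 * (\<epsilon> * n))"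
  proof (rule sum_mono)
    fix p assume p: "p \<in> F \<times> F"
    have "real (card (M p \<union> N p)) \<le> real (card (M p)) + real (card (N p))"
      using card_Un_le[of "M p" "N p"] by linarith
    then show "real (card (M p \<union> N p)) \<le> 2 * (\<epsilon> * n)" using M[OF p] N[OF p] by linarith
  qed
  also have "\<dots> = \<delta> * n" using pos by (simp add: \<epsilon>_def field_simps)
  finally have B: "real (card B) \<le> \<delta> * n" .
  define H where "H = {..<n} - B"
  have "B \<subseteq> {..<n}" by (auto simp: B_def M_def N_def)
  then have "card H + card B = n"
    using card_mono[of "{..<n}" B] by (simp add: H_def card_Diff_subset finite_subset)
  then have H: "real (card H) + real (card B) = n" by (simp flip: of_nat_add)
  have hom: "\<phi> (g + h) v = \<phi> g (\<phi> h v)" if "v \<in> H" "g \<in> F" "h \<in> F" for v g h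
    using that unfolding H_def B_def M_def by force
  have inj: "g = h" if "v \<in> H" "g \<in> F" "h \<in> F" "\<phi> g v = \<phi> h v" for v g h
    using that unfolding H_def B_def N_def by force
  show ?thesis
  proof (rule that[of n "\<lambda>g. \<phi> (- g)" H])
    show "(1 - \<delta>) * real n \<le> real (card H)" using H B by (simp add: algebra_simps)
    show "\<forall>v\<in>H. \<forall>g\<in>E. \<forall>h\<in>E. \<phi> (- h) (\<phi> (- g) v) = \<phi> (- (g + h)) v"
    proof (intro ballI)
      fix v g h assume "v \<in> H" "g \<in> E" "h \<in> E"
      then show "\<phi> (- h) (\<phi> (- g) v) = \<phi> (- (g + h)) v"
        using hom[of v "- h" "- g"] by (simp add: F_def minus_add)
    qed
    show "\<forall>v\<in>H. inj_on (\<lambda>g. \<phi> (- g) v) E"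
    proof (intro ballI inj_onI)
      fix v g h
      assume "v \<in> H" "g \<in> E" "h \<in> E" "\<phi> (- g) v = \<phi> (- h) v"
      then show "g = h" using inj[of v "- g" "- h"] by (simp add: F_def)
    qed
    show "\<forall>v\<in>H. \<phi> (- 0) v = v"
    proof
      fix v assume "v \<in> H"
      \<comment> \<open>The permutation \<open>\<phi> 0\<close> is idempotent at \<open>v\<close>, and it is injective.\<close>
      have "0 \<in> F" using \<open>0 \<in> E\<close> by (force simp: F_def)
      then have "\<phi> 0 (\<phi> 0 v) = \<phi> 0 v" using hom[OF \<open>v \<in> H\<close>, of 0 0] by simp
      then show "\<phi> (- 0) v = v" using permutes_inj[OF perm[of 0]] by (simp add: inj_eq)
    qed
  qed (use n perm in \<open>auto simp: H_def\<close>)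
qed

text \<open>
  By maximality, every \<open>N w\<close> meets some member of a maximal disjoint subfamily, and each member is met by
  at most \<open>K\<close> of the sets.
\<close>
lemma disjoint_subfamily_exists:
  assumes "finite H"
    and "\<And>v. v \<in> H \<Longrightarrow> N v \<noteq> {}"
    and "\<And>v. v \<in> H \<Longrightarrow> card {w \<in> H. N w \<inter> N v \<noteq> {}} \<le> K"
  obtains S where "S \<subseteq> H" "disjoint_family_on N S" "card H \<le> K * card S"
proof -
  define \<S> where "\<S> = {S. S \<subseteq> H \<and> disjoint_family_on N S}"
  have "finite \<S>" "\<S> \<noteq> {}" using \<open>finite H\<close> by (auto simp: \<S>_def disjoint_family_on_def)
  then obtain S where S: "S \<in> \<S>" and max: "\<And>S'. S' \<in> \<S> \<Longrightarrow> S \<subseteq> S' \<Longrightarrow> S' = S"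
    using finite_has_maximal by (metis (no_types, lifting))
  have SH: "S \<subseteq> H" and "finite S" using S \<open>finite H\<close> finite_subset by (auto simp: \<S>_def)
  have "\<exists>s\<in>S. N w \<inter> N s \<noteq> {}" if w: "w \<in> H" for w
  proof (rule ccontr)
    assume *: "\<not> ?thesis"
    then have "insert w S \<in> \<S>"
      using S w by (auto simp: \<S>_def disjoint_family_on_def Int_commute)
    then have "w \<in> S" using max by blast
    then show False using * assms(2)[OF w] by blast
  qed
  then have "H \<subseteq> (\<Union>s\<in>S. {w \<in> H. N w \<inter> N s \<noteq> {}})" by blast
  then have "card H \<le> card (\<Union>s\<in>S. {w \<in> H. N w \<inter> N s \<noteq> {}})"
    using \<open>finite S\<close> \<open>finite H\<close> by (intro card_mono) auto
  also have "\<dots> \<le> (\<Sum>s\<in>S. card {w \<in> H. N w \<inter> N s \<noteq> {}})" by (rule card_UN_le[OF \<open>finite S\<close>])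
  also have "\<dots> \<le> (\<Sum>s\<in>S. K)" using SH assms(3) by (intro sum_mono) blast
  finally have "card H \<le> K * card S" by (simp add: mult.commute)
  then show ?thesis using S by (intro that) (auto simp: \<S>_def)
qed

section \<open>Direct finiteness\<close>

text \<open>
  In terms of cellular automata, \<open>\<beta>\<close> induces an injective one, and a nonzero \<open>P\<close> would be an algebraic
  relation satisfied everywhere on its image.  So this is a polynomial form of the theorem that sofic
  groups are surjunctive.
\<close>
lemma star_right_cancel_zero:
  fixes \<alpha> \<beta> P :: "('g::group_add, 'k::field) near_ring"
  assumes "sofic TYPE('g)" and inv: "\<alpha> \<star> \<beta> = var 0" and zero: "P \<star> \<beta> = 0"
  shows "P = 0"
proof (rule ccontr)
  assume "P \<noteq> 0"
  define E where "E = insert 0 (vars \<alpha> \<union> vars \<beta> \<union> vars P)"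
  have E: "finite E" "0 \<in> E" by (simp_all add: E_def finite_vars)
  have "vars \<beta> \<subseteq> E" by (auto simp: E_def)
  define K where "K = card (E \<times> E)"
  \<comment> \<open>With at least \<open>(1 - \<delta>) n\<close> points in \<open>H\<close> and \<open>card H \<le> K * card S\<close>, the bound
    \<open>card H + card S \<le> n\<close> gives \<open>(K + 1) (1 - \<delta>) n \<le> K n\<close>.  This choice makes the left side
    \<open>(K + 1/2) n\<close>.\<close>
  define \<delta> :: real where "\<delta> = 1 / (2 * (real K + 1))"
  have "\<delta> > 0" by (simp add: \<delta>_def add_nonneg_pos)
  obtain n \<psi> H where n: "n \<ge> 1" and perm: "\<forall>g. \<psi> g permutes {..<n}"
    and H: "H \<subseteq> {..<n}" "real (card H) \<ge> (1 - \<delta>) * real n"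
    and hom: "\<forall>v\<in>H. \<forall>g\<in>E. \<forall>h\<in>E. \<psi> h (\<psi> g v) = \<psi> (g + h) v"
    and inj: "\<forall>v\<in>H. inj_on (\<lambda>g. \<psi> g v) E"
    and unit: "\<forall>v\<in>H. \<psi> 0 v = v"
    using sofic_finite_model[OF assms(1) E \<open>\<delta> > 0\<close>] .
  have "finite H" using H(1) finite_subset by blast
  define transfer :: "('g, 'k) near_ring \<Rightarrow> nat \<Rightarrow> (nat, 'k) near_ring"
    where "transfer \<gamma> v = poly_subst (\<lambda>g. var (\<psi> g v)) \<gamma>" for \<gamma> v
  \<comment> \<open>On \<open>H\<close> the transfer turns \<open>\<star>\<close> into substitution, as \<open>\<psi>\<close> is multiplicative there.\<close>
  have transfer_star: "poly_subst (transfer \<beta>) (transfer \<gamma> v) = transfer (\<gamma> \<star> \<beta>) v"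
    if v: "v \<in> H" and \<gamma>: "vars \<gamma> \<subseteq> E" for \<gamma> v
  proof -
    have "poly_subst (transfer \<beta>) (transfer \<gamma> v) = poly_subst (\<lambda>g. transfer \<beta> (\<psi> g v)) \<gamma>"
      by (simp add: transfer_def[of \<gamma>] poly_subst_poly_subst)
    also have "\<dots> = poly_subst (\<lambda>g. transfer (act g \<beta>) v) \<gamma>"
    proof (rule poly_subst_cong)
      fix g assume "g \<in> vars \<gamma>"
      then have "g \<in> E" using \<gamma> by blast
      then show "transfer \<beta> (\<psi> g v) = transfer (act g \<beta>) v"
        unfolding transfer_def act_eq_poly_subst poly_subst_poly_subst poly_subst_var
        by (intro poly_subst_cong) (use hom v \<open>g \<in> E\<close> \<open>vars \<beta> \<subseteq> E\<close> in auto)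
    qed
    also have "\<dots> = transfer (\<gamma> \<star> \<beta>) v"
      by (simp add: transfer_def[of _ v] star_eq_poly_subst poly_subst_poly_subst)
    finally show ?thesis .
  qed
  have vars_transfer: "vars (transfer \<gamma> v) \<subseteq> (\<lambda>g. \<psi> g v) ` vars \<gamma>" for \<gamma> v
    unfolding transfer_def by (rule vars_poly_subst_vars)
  have in_V: "\<psi> g v \<in> {..<n}" if "v \<in> H" for g v
    using permutes_in_image[OF perm[rule_format, of g], of v] H(1) that by blast
  \<comment> \<open>If \<open>N w\<close> meets \<open>N v\<close>, then \<open>w\<close> is determined by \<open>v\<close> and a pair in \<open>E \<times> E\<close>, because each \<open>\<psi> g\<close> is
    injective; hence the bound \<open>K\<close>.\<close>
  define N where "N v = (\<lambda>g. \<psi> g v) ` E" for v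
  have "card {w \<in> H. N w \<inter> N v \<noteq> {}} \<le> K" for v
  proof -
    have "{w \<in> H. N w \<inter> N v \<noteq> {}} \<subseteq> (\<lambda>(g, h). inv (\<psi> g) (\<psi> h v)) ` (E \<times> E)"
    proof
      fix w assume "w \<in> {w \<in> H. N w \<inter> N v \<noteq> {}}"
      then obtain g h where gh: "g \<in> E" "h \<in> E" "\<psi> g w = \<psi> h v" by (auto simp: N_def)
      then have "w = inv (\<psi> g) (\<psi> h v)" using permutes_inverses(2)[OF perm[rule_format, of g], of w] by simp
      then show "w \<in> (\<lambda>(g, h). inv (\<psi> g) (\<psi> h v)) ` (E \<times> E)" using gh by force
    qed
    then show ?thesis unfolding K_def using E(1) by (intro surj_card_le) auto
  qed
  moreover have "N v \<noteq> {}" for v using E by (auto simp: N_def)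
  ultimately obtain S where S: "S \<subseteq> H" "disjoint_family_on N S" "card H \<le> K * card S"
    using disjoint_subfamily_exists[OF \<open>finite H\<close>, of N K] by metis
  have "card H + card S \<le> card {..<n}"
  proof (rule card_generated_plus_relations_le[where \<theta> = "transfer \<beta>"
        and A = "transfer \<alpha>" and Q = "transfer P"])
    show "finite S" using S(1) \<open>finite H\<close> finite_subset by blast
    fix v assume v: "v \<in> H"
    show "poly_subst (transfer \<beta>) (transfer \<alpha> v) = var v"
      by (subst transfer_star[OF v]) (auto simp: E_def inv transfer_def unit v)
    show "vars (transfer \<alpha> v) \<subseteq> {..<n}" using vars_transfer[of \<alpha> v] in_V[OF v] by blast
  next
    fix s assume "s \<in> S"
    then have s: "s \<in> H" using S(1) by blast
    show "poly_subst (transfer \<beta>) (transfer P s) = 0"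
      by (subst transfer_star[OF s]) (auto simp: E_def zero transfer_def)
    show "transfer P s \<noteq> 0" unfolding transfer_def
      by (rule poly_subst_vars_nonzero[OF inj_on_subset[OF bspec[OF inj s]] \<open>P \<noteq> 0\<close>]) (auto simp: E_def)
    show "vars (transfer P s) \<subseteq> {..<n}" using vars_transfer[of P s] in_V[OF s] by blast
  next
    have "vars (transfer P s) \<subseteq> N s" for s
      using vars_transfer[of P s] by (auto simp: N_def E_def)
    then show "disjoint_family_on (\<lambda>s. vars (transfer P s)) S"
      using S(2) unfolding disjoint_family_on_def by blast
  qed (use H in auto)
  then have "real K * real (card H) + real K * real (card S) \<le> real K * real n"
    by (simp flip: of_nat_add of_nat_mult distrib_left)
  moreover have "real (card H) \<le> real K * real (card S)"
    using S(3) by (simp flip: of_nat_mult)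
  ultimately have "(real K + 1) * real (card H) \<le> real K * real n"
    by (simp add: algebra_simps)
  moreover have "(real K + 1) * ((1 - \<delta>) * real n) \<le> (real K + 1) * real (card H)"
    using H(2) by (intro mult_left_mono) auto
  moreover have "(real K + 1) * ((1 - \<delta>) * real n) = (real K + 1 / 2) * real n"
    by (simp add: \<delta>_def field_simps)
  ultimately show False using n by (simp add: algebra_simps)
qed

theorem theoremA:
  fixes \<alpha> \<beta> :: "('g::group_add, 'k::field) near_ring"
  assumes "sofic TYPE('g)"
    and "\<alpha> \<star> \<beta> = var 0"
  shows "\<beta> \<star> \<alpha> = var 0"
proof -
  have "(\<beta> \<star> \<alpha> - var 0) \<star> \<beta> = 0"
    by (simp add: star_diff_left star_assoc assms(2) star_var_0 var_0_star)
  then have "\<beta> \<star> \<alpha> - var 0 = 0"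
    by (rule star_right_cancel_zero[OF assms])
  then show ?thesis by simp
qed

end
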